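(* Let $\mathcal T$ be the vector space spanned by rooted trees, $\mathcal H=S(\mathcal T)$, and let $V$ be the vector space spanned by the couples $(t,s)$ where $t$ is a rooted tree and $s=P^{c_0}(t)$ is the pruning of $t$ by an admissible cut $c_0$ of $t$. Let $P_2:V\to\mathcal H$, $(t,s)\mapsto s$, be the projection on the second component. For $t_1\in\mathcal T$ and $(t_2,s_2)\in V$ let $$t_1\Diamond(t_2,s_2):=\sum_{v\in\mathcal V(s_2)}(t_1\rightarrow_v t_2,\,t_1\rightarrow_v s_2),$$ extended bilinearly. Then $$P_2\circ\Diamond=\;\rightarrow\circ\,(I\otimes P_2)\quad\text{as maps }\mathcal T\otimes V\to\mathcal H,$$ that is, $P_2\big(t_1\Diamond(t_2,s_2)\big)=t_1\rightarrow P_2(t_2,s_2)$ for all $t_1\in\mathcal T$, $(t_2,s_2)\in V$. In other words, $P_2$ is a morphism of pre-Lie modules.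
   Context: Rooted trees are finite, non-planar, non-empty. A forest is a finite (possibly empty) disjoint union of rooted trees; forests form a basis of $\mathcal H=S(\mathcal T)$. For a tree $t$, a tree or forest $s$, and a vertex $v$ of $s$, $t\rightarrow_v s$ is obtained by grafting the root of $t$ on the vertex $v$ of $s$. The map $\rightarrow:\mathcal T\otimes\mathcal H\to\mathcal H$ is $t\rightarrow s=\sum_v t\rightarrow_v s$, summed over all vertices $v$ of the forest $s$ (so $t\rightarrow\mathbf 1=0$ for the empty forest $\mathbf 1$). Restricted to $\mathcal T\otimes\mathcal T$ it is the grafting pre-Lie product. An admissible cut $c$ of a tree $t$ is a collection of edges such that any path from the root to a leaf contains at most one edge of the collection. The pruning $P^c(t)$ is the subforest above the cut. The empty cut (pruning empty) and the total cut (pruning $t$) are both counted as admissible. In a couple $(t,s)\in V$, $s$ is regarded as a subforest of $t$, and $\mathcal V(s)$ is its set of vertices. A left module over a left pre-Lie algebra $(\mathcal A,\circ)$ is a vector space $\mathcal M$ with a bilinear map $\succ:\mathcal A\otimes\mathcal M\to\mathcal M$ such that $a\succ(b\succ m)-(a\circ b)\succ m=b\succ(a\succ m)-(b\circ a)\succ m$. A morphism of such modules is a linear map commuting with the maps $\succ$. $I$ is the identity. *)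

theory Defs
  imports Complex_Main "HOL-Library.Poly_Mapping" "HOL-Library.Nat_Bijection"
begin

section \<open>Concrete rooted trees and forests\<close>

text \<open>Edges are oriented away from the root: \<open>(u, v)\<close> means that \<open>u\<close> is the parent of \<open>v\<close>.\<close>

datatype 'v rgraph = RGraph (verts: "'v set") (edges: "('v \<times> 'v) set")

definition is_root :: "'v rgraph \<Rightarrow> 'v \<Rightarrow> bool" where
  "is_root g r \<longleftrightarrow> r \<in> verts g \<and> (\<forall>u. (u, r) \<notin> edges g)"

definition is_leaf :: "'v rgraph \<Rightarrow> 'v \<Rightarrow> bool" where
  "is_leaf g l \<longleftrightarrow> l \<in> verts g \<and> (\<forall>u. (l, u) \<notin> edges g)"

definition rooted_tree :: "'v rgraph \<Rightarrow> bool" where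
  "rooted_tree g \<longleftrightarrow>
     finite (verts g) \<and> edges g \<subseteq> verts g \<times> verts g \<and>
     (\<forall>u u' v. (u, v) \<in> edges g \<longrightarrow> (u', v) \<in> edges g \<longrightarrow> u = u') \<and>
     (\<exists>r. is_root g r \<and> (\<forall>v\<in>verts g. (r, v) \<in> (edges g)\<^sup>*))"

definition tree_root :: "'v rgraph \<Rightarrow> 'v" where
  "tree_root g = (THE r. is_root g r)"

definition rooted_forest :: "'v rgraph \<Rightarrow> bool" where
  "rooted_forest g \<longleftrightarrow>
     (\<exists>F. finite F \<and> (\<forall>t\<in>F. rooted_tree t) \<and>
          (\<forall>t\<in>F. \<forall>t'\<in>F. t \<noteq> t' \<longrightarrow> verts t \<inter> verts t' = {}) \<and>
          g = RGraph (\<Union>t\<in>F. verts t) (\<Union>t\<in>F. edges t))"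

definition relabel :: "('v \<Rightarrow> 'w) \<Rightarrow> 'v rgraph \<Rightarrow> 'w rgraph" where
  "relabel f g = RGraph (f ` verts g) (map_prod f f ` edges g)"

definition rgraph_iso :: "'v rgraph \<Rightarrow> 'w rgraph \<Rightarrow> bool" where
  "rgraph_iso g h \<longleftrightarrow> (\<exists>f. inj_on f (verts g) \<and> relabel f g = h)"

text \<open>Grafting the root of \<open>t\<close> on the vertex \<open>v\<close> of \<open>s\<close>. To make the vertex sets disjoint, the
  vertices of \<open>s\<close> are renamed by \<open>sum_encode \<circ> Inl\<close> and those of \<open>t\<close> by \<open>sum_encode \<circ> Inr\<close>.\<close>

definition graft_at :: "nat rgraph \<Rightarrow> nat \<Rightarrow> nat rgraph \<Rightarrow> nat rgraph" where
  "graft_at t v s =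
     (let s' = relabel (sum_encode \<circ> Inl) s; t' = relabel (sum_encode \<circ> Inr) t
      in RGraph (verts s' \<union> verts t')
           (edges s' \<union> edges t' \<union> {(sum_encode (Inl v), sum_encode (Inr (tree_root t)))}))"


section \<open>Admissible cuts and prunings\<close>

text \<open>The total cut is not a set of edges of the tree, hence the separate constructor; the empty
  cut is \<open>Edge_Cut {}\<close>.\<close>

datatype 'v cut = Total_Cut | Edge_Cut "('v \<times> 'v) set"

definition root_leaf_path :: "'v rgraph \<Rightarrow> 'v list \<Rightarrow> bool" where
  "root_leaf_path g p \<longleftrightarrow>
     p \<noteq> [] \<and> hd p = tree_root g \<and> is_leaf g (last p) \<and> successively (\<lambda>u v. (u, v) \<in> edges g) p"

definition path_edges :: "'v list \<Rightarrow> ('v \<times> 'v) set" where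
  "path_edges p = set (zip p (tl p))"

fun admissible_cut :: "'v rgraph \<Rightarrow> 'v cut \<Rightarrow> bool" where
  "admissible_cut t Total_Cut \<longleftrightarrow> True"
| "admissible_cut t (Edge_Cut C) \<longleftrightarrow>
     C \<subseteq> edges t \<and> (\<forall>p. root_leaf_path t p \<longrightarrow> card (C \<inter> path_edges p) \<le> 1)"

definition induced :: "'v rgraph \<Rightarrow> 'v set \<Rightarrow> 'v rgraph" where
  "induced g W = RGraph W (edges g \<inter> W \<times> W)"

fun pruning :: "'v rgraph \<Rightarrow> 'v cut \<Rightarrow> 'v rgraph" where
  "pruning t Total_Cut = t"
| "pruning t (Edge_Cut C) = induced t {w. \<exists>(u, v)\<in>C. (v, w) \<in> (edges t)\<^sup>*}"

definition is_couple :: "'v rgraph \<times> 'v rgraph \<Rightarrow> bool" where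
  "is_couple = (\<lambda>(t, s). rooted_tree t \<and> (\<exists>c. admissible_cut t c \<and> s = pruning t c))"

text \<open>In a couple \<open>(t, s)\<close> the forest \<open>s\<close> is a subforest of \<open>t\<close>, so that an isomorphism of couples
  is an isomorphism of the trees that carries the one subforest onto the other. This is finer than
  isomorphism of the two components separately.\<close>

definition couple_iso :: "'v rgraph \<times> 'v rgraph \<Rightarrow> 'w rgraph \<times> 'w rgraph \<Rightarrow> bool" where
  "couple_iso = (\<lambda>(t, s) (t', s').
     \<exists>f. inj_on f (verts t) \<and> relabel f t = t' \<and> relabel f s = s')"


section \<open>Isomorphism classes\<close>

lemma relabel_comp: "relabel f (relabel g x) = relabel (f \<circ> g) x"
  by (auto simp: relabel_def image_image prod.map_comp)

lemma relabel_id_on: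
  assumes "edges x \<subseteq> verts x \<times> verts x" "\<And>v. v \<in> verts x \<Longrightarrow> f v = v"
  shows "relabel f x = x"
proof -
  have "map_prod f f e = e" if "e \<in> edges x" for e
    using that assms by (cases e) auto
  moreover have "f ` verts x = verts x"
    using assms(2) by simp
  ultimately show ?thesis
    by (cases x) (auto simp: relabel_def)
qed

lemma verts_relabel [simp]: "verts (relabel f x) = f ` verts x"
  by (simp add: relabel_def)

lemma edges_tree: "rooted_tree x \<Longrightarrow> edges x \<subseteq> verts x \<times> verts x"
  by (simp add: rooted_tree_def)

lemma edges_forest: "rooted_forest x \<Longrightarrow> edges x \<subseteq> verts x \<times> verts x"
  unfolding rooted_forest_def using edges_tree by fastforce

lemma couple_iso_sym:
  assumes s: "verts s \<subseteq> verts t" and et: "edges t \<subseteq> verts t \<times> verts t"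
    and es: "edges s \<subseteq> verts s \<times> verts s" and iso: "couple_iso (t, s) (t', s')"
  shows "couple_iso (t', s') (t, s)"
proof -
  obtain f where f: "inj_on f (verts t)" "relabel f t = t'" "relabel f s = s'"
    using iso by (auto simp: couple_iso_def)
  let ?g = "inv_into (verts t) f"
  have "inj_on ?g (verts t')"
    using f(2) by (auto intro: inj_on_inv_into)
  moreover have "relabel ?g t' = t"
    using f(1) et unfolding f(2)[symmetric] relabel_comp by (intro relabel_id_on) auto
  moreover have "relabel ?g s' = s"
    using f(1) s es unfolding f(3)[symmetric] relabel_comp by (intro relabel_id_on) auto
  ultimately show ?thesis
    by (auto simp: couple_iso_def)
qed

lemma couple_iso_trans:
  assumes "couple_iso (t, s) (t', s')" "couple_iso (t', s') (t'', s'')"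
  shows "couple_iso (t, s) (t'', s'')"
proof -
  obtain f g where "inj_on f (verts t)" "relabel f t = t'" "relabel f s = s'"
      "inj_on g (verts t')" "relabel g t' = t''" "relabel g s' = s''"
    using assms by (auto simp: couple_iso_def)
  then show ?thesis
    by (auto simp: couple_iso_def relabel_comp intro!: exI[of _ "g \<circ> f"] comp_inj_on)
qed

lemma rgraph_iso_couple_iso: "rgraph_iso g h \<longleftrightarrow> couple_iso (g, g) (h, h)"
  by (auto simp: rgraph_iso_def couple_iso_def)

lemma rgraph_iso_sym:
  "edges g \<subseteq> verts g \<times> verts g \<Longrightarrow> rgraph_iso g h \<Longrightarrow> rgraph_iso h g"
  by (simp add: rgraph_iso_couple_iso couple_iso_sym)

lemma rgraph_iso_trans: "rgraph_iso g h \<Longrightarrow> rgraph_iso h k \<Longrightarrow> rgraph_iso g k"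
  unfolding rgraph_iso_couple_iso by (rule couple_iso_trans)

lemma rgraph_iso_refl: "rgraph_iso g g"
proof -
  have "relabel id g = g"
    by (cases g) (simp add: relabel_def prod.map_id0)
  then show ?thesis
    unfolding rgraph_iso_def by (intro exI[of _ id]) simp
qed

lemma pruning_subgraph:
  assumes "rooted_tree t" "admissible_cut t c"
  shows "verts (pruning t c) \<subseteq> verts t"
    and "edges (pruning t c) \<subseteq> verts (pruning t c) \<times> verts (pruning t c)"
proof -
  note et = edges_tree[OF assms(1)]
  have *: "w \<in> verts t" if "(v, w) \<in> (edges t)\<^sup>*" "v \<in> verts t" for v w
    using that et by (induction rule: rtrancl_induct) auto
  show "verts (pruning t c) \<subseteq> verts t"
    using assms et * by (cases c) (fastforce simp: induced_def)+
  show "edges (pruning t c) \<subseteq> verts (pruning t c) \<times> verts (pruning t c)"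
    using et by (cases c) (auto simp: induced_def)
qed

definition tree_rel :: "nat rgraph \<Rightarrow> nat rgraph \<Rightarrow> bool" where
  "tree_rel g h \<longleftrightarrow> rooted_tree g \<and> rooted_tree h \<and> rgraph_iso g h"

definition forest_rel :: "nat rgraph \<Rightarrow> nat rgraph \<Rightarrow> bool" where
  "forest_rel g h \<longleftrightarrow> rooted_forest g \<and> rooted_forest h \<and> rgraph_iso g h"

definition couple_rel :: "nat rgraph \<times> nat rgraph \<Rightarrow> nat rgraph \<times> nat rgraph \<Rightarrow> bool" where
  "couple_rel x y \<longleftrightarrow> is_couple x \<and> is_couple y \<and> couple_iso x y"

lemma rooted_tree_single: "rooted_tree (RGraph {v} {})"
  by (simp add: rooted_tree_def is_root_def)

quotient_type rtree = "nat rgraph" / partial: tree_rel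
proof (rule part_equivpI)
  show "\<exists>x. tree_rel x x"
    unfolding tree_rel_def
    by (intro exI[of _ "RGraph {0} {}"] conjI rooted_tree_single rgraph_iso_refl)
  show "symp tree_rel"
    by (auto intro!: sympI simp: tree_rel_def rgraph_iso_sym edges_tree)
  show "transp tree_rel"
    by (auto intro!: transpI simp: tree_rel_def intro: rgraph_iso_trans)
qed

quotient_type rforest = "nat rgraph" / partial: forest_rel
proof (rule part_equivpI)
  have "rooted_forest (RGraph {} {})"
    by (auto simp: rooted_forest_def)
  then show "\<exists>x. forest_rel x x"
    unfolding forest_rel_def by (intro exI[of _ "RGraph {} {}"] conjI rgraph_iso_refl)
  show "symp forest_rel"
    by (auto intro!: sympI simp: forest_rel_def rgraph_iso_sym edges_forest)
  show "transp forest_rel"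
    by (auto intro!: transpI simp: forest_rel_def intro: rgraph_iso_trans)
qed

quotient_type couple = "nat rgraph \<times> nat rgraph" / partial: couple_rel
proof (rule part_equivpI)
  let ?t = "RGraph {0::nat} {}"
  have "is_couple (?t, ?t)"
    using rooted_tree_single by (auto simp: is_couple_def intro!: exI[of _ Total_Cut])
  moreover have "couple_iso (?t, ?t) (?t, ?t)"
    using rgraph_iso_refl by (simp flip: rgraph_iso_couple_iso)
  ultimately show "\<exists>x. couple_rel x x"
    unfolding couple_rel_def by blast
  show "symp couple_rel"
  proof (rule sympI)
    fix x y assume xy: "couple_rel x y"
    obtain t s t' s' where x: "x = (t, s)" and y: "y = (t', s')"
      by (cases x; cases y)
    obtain c where t: "rooted_tree t" and c: "admissible_cut t c" and s: "s = pruning t c"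
      using xy by (auto simp: couple_rel_def is_couple_def x)
    have "couple_iso (t', s') (t, s)"
    proof (rule couple_iso_sym)
      show "couple_iso (t, s) (t', s')"
        using xy by (simp add: couple_rel_def x y)
    qed (simp_all only: s pruning_subgraph[OF t c] edges_tree[OF t])
    then show "couple_rel y x"
      using xy by (simp add: couple_rel_def x y)
  qed
  show "transp couple_rel"
    by (rule transpI) (auto simp: couple_rel_def intro: couple_iso_trans)
qed


section \<open>Linear extensions to spaces of finitely supported functions\<close>

text \<open>The vector space with basis \<open>'b\<close> over the field \<open>'k\<close> is \<open>'b \<Rightarrow>\<^sub>0 'k\<close>, and \<open>basis_vec b\<close> is the
  basis vector given by \<open>b\<close>.\<close>

definition vscale :: "'k::field \<Rightarrow> ('b \<Rightarrow>\<^sub>0 'k) \<Rightarrow> ('b \<Rightarrow>\<^sub>0 'k)" where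
  "vscale c p = Poly_Mapping.map ((*) c) p"

definition basis_vec :: "'b \<Rightarrow> ('b \<Rightarrow>\<^sub>0 'k::field)" where
  "basis_vec b = Poly_Mapping.single b 1"

definition lin_ext :: "('a \<Rightarrow> ('b \<Rightarrow>\<^sub>0 'k::field)) \<Rightarrow> ('a \<Rightarrow>\<^sub>0 'k) \<Rightarrow> ('b \<Rightarrow>\<^sub>0 'k)" where
  "lin_ext f p = (\<Sum>a\<in>Poly_Mapping.keys p. vscale (Poly_Mapping.lookup p a) (f a))"

definition bilin_ext ::
    "('a \<Rightarrow> 'b \<Rightarrow> ('c \<Rightarrow>\<^sub>0 'k::field)) \<Rightarrow> ('a \<Rightarrow>\<^sub>0 'k) \<Rightarrow> ('b \<Rightarrow>\<^sub>0 'k) \<Rightarrow> ('c \<Rightarrow>\<^sub>0 'k)" where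
  "bilin_ext f p q = lin_ext (\<lambda>a. lin_ext (f a) q) p"


section \<open>Grafting, the diamond map and the projection\<close>

text \<open>Vertices are those of a chosen representative of the isomorphism class; the sums do not
  depend on the choice.\<close>

definition graft_tree :: "(rtree \<Rightarrow>\<^sub>0 'k::field) \<Rightarrow> (rtree \<Rightarrow>\<^sub>0 'k) \<Rightarrow> (rtree \<Rightarrow>\<^sub>0 'k)" where
  "graft_tree = bilin_ext (\<lambda>t s.
     \<Sum>v\<in>verts (rep_rtree s). basis_vec (abs_rtree (graft_at (rep_rtree t) v (rep_rtree s))))"

definition graft_forest :: "(rtree \<Rightarrow>\<^sub>0 'k::field) \<Rightarrow> (rforest \<Rightarrow>\<^sub>0 'k) \<Rightarrow> (rforest \<Rightarrow>\<^sub>0 'k)" where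
  "graft_forest = bilin_ext (\<lambda>t s.
     \<Sum>v\<in>verts (rep_rforest s). basis_vec (abs_rforest (graft_at (rep_rtree t) v (rep_rforest s))))"

definition diamond :: "(rtree \<Rightarrow>\<^sub>0 'k::field) \<Rightarrow> (couple \<Rightarrow>\<^sub>0 'k) \<Rightarrow> (couple \<Rightarrow>\<^sub>0 'k)" where
  "diamond = bilin_ext (\<lambda>t1 x.
     let (t2, s2) = rep_couple x
     in \<Sum>v\<in>verts s2.
          basis_vec (abs_couple (graft_at (rep_rtree t1) v t2, graft_at (rep_rtree t1) v s2)))"

definition P2 :: "(couple \<Rightarrow>\<^sub>0 'k::field) \<Rightarrow> (rforest \<Rightarrow>\<^sub>0 'k)" where
  "P2 = lin_ext (\<lambda>x. basis_vec (abs_rforest (snd (rep_couple x))))"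


section \<open>Left pre-Lie algebras and modules\<close>

definition bilinear_map ::
    "('k::field \<Rightarrow> 'a::ab_group_add \<Rightarrow> 'a) \<Rightarrow> ('k \<Rightarrow> 'b::ab_group_add \<Rightarrow> 'b) \<Rightarrow>
     ('k \<Rightarrow> 'c::ab_group_add \<Rightarrow> 'c) \<Rightarrow> ('a \<Rightarrow> 'b \<Rightarrow> 'c) \<Rightarrow> bool" where
  "bilinear_map s1 s2 s3 f \<longleftrightarrow>
     (\<forall>x. Vector_Spaces.linear s2 s3 (f x)) \<and> (\<forall>y. Vector_Spaces.linear s1 s3 (\<lambda>x. f x y))"

locale left_pre_lie_algebra = vector_space scaleA
  for scaleA :: "'k::field \<Rightarrow> 'a::ab_group_add \<Rightarrow> 'a" +
  fixes prod :: "'a \<Rightarrow> 'a \<Rightarrow> 'a"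
  assumes bilinear_prod: "bilinear_map scaleA scaleA scaleA prod"
    and pre_lie:
      "prod a (prod b c) - prod (prod a b) c = prod b (prod a c) - prod (prod b a) c"

locale left_pre_lie_module =
  left_pre_lie_algebra scaleA prod + M: vector_space scaleM
  for scaleA :: "'k::field \<Rightarrow> 'a::ab_group_add \<Rightarrow> 'a"
    and prod :: "'a \<Rightarrow> 'a \<Rightarrow> 'a"
    and scaleM :: "'k \<Rightarrow> 'm::ab_group_add \<Rightarrow> 'm" +
  fixes act :: "'a \<Rightarrow> 'm \<Rightarrow> 'm"
  assumes bilinear_act: "bilinear_map scaleA scaleM scaleM act"
    and pre_lie_act:
      "act a (act b m) - act (prod a b) m = act b (act a m) - act (prod b a) m"

locale pre_lie_module_morphism =
  M: left_pre_lie_module scaleA prod scaleM actM +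
  N: left_pre_lie_module scaleA prod scaleN actN +
  Vector_Spaces.linear scaleM scaleN f
  for scaleA :: "'k::field \<Rightarrow> 'a::ab_group_add \<Rightarrow> 'a"
    and prod :: "'a \<Rightarrow> 'a \<Rightarrow> 'a"
    and scaleM :: "'k \<Rightarrow> 'm::ab_group_add \<Rightarrow> 'm"
    and actM :: "'a \<Rightarrow> 'm \<Rightarrow> 'm"
    and scaleN :: "'k \<Rightarrow> 'n::ab_group_add \<Rightarrow> 'n"
    and actN :: "'a \<Rightarrow> 'n \<Rightarrow> 'n"
    and f :: "'m \<Rightarrow> 'n" +
  assumes commutes: "f (actM a m) = actN a (f m)"

end

theory Submission
  imports Defs
begin

text \<open>
  Prunings of \<open>t\<close> are exactly the subgraphs induced on vertex sets closed under passing to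
  children, which makes them stable under grafting on one of their vertices. If \<open>b\<close> is grafted on
  \<open>m\<close> and then \<open>a\<close> on the result, then \<open>a\<close> lands either on a vertex of \<open>b\<close>, which amounts to
  grafting \<open>a \<rightarrow> b\<close> on \<open>m\<close>, or on a vertex of \<open>m\<close>, and the sum of the latter terms is symmetric
  in \<open>a\<close> and \<open>b\<close>. This gives the pre-Lie identity at once for trees, forests and couples. The
  map \<open>P2\<close> is a morphism since the diamond map sums over the vertices of the second component.
\<close>

section \<open>Forests and couples of graphs\<close>

lemma root_unique:
  assumes uniq: "\<And>u u' v. (u, v) \<in> edges g \<Longrightarrow> (u', v) \<in> edges g \<Longrightarrow> u = u'"
    and "is_root g r" "is_root g r'" "(r, v) \<in> (edges g)\<^sup>*" "(r', v) \<in> (edges g)\<^sup>*"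
  shows "r = r'"
  using assms(4,5)
\<comment> \<open>Both paths are traced back from \<open>v\<close>. Unique parents lead them through
  the same vertices, and a root has no parent, so neither path can continue beyond the start of the
  other.\<close>
proof (induction rule: rtrancl_induct)
  case base
  then show ?case
    using assms(2) by (auto simp: is_root_def elim: rtranclE)
next
  case (step y z)
  from step.prems show ?case
  proof (cases rule: rtranclE)
    case base
    then show ?thesis
      using assms(3) step.hyps by (auto simp: is_root_def)
  next
    case (step y')
    then show ?thesis
      using step.IH uniq \<open>(y, z) \<in> edges g\<close> by blast
  qed
qed

text \<open>A path ending in a root is trivial, since a root has no parent. Hence every root equals
  the vertex from which the whole tree is reachable, and the description in \<open>tree_root\<close>
  is well defined.\<close>

lemma tree_root_eqI:
  assumes "rooted_tree t" "is_root t r"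
  shows "tree_root t = r"
proof -
  obtain q where q: "is_root t q" "\<And>v. v \<in> verts t \<Longrightarrow> (q, v) \<in> (edges t)\<^sup>*"
    using assms(1) by (auto simp: rooted_tree_def)
  have "r' = q" if "is_root t r'" for r'
    using q(2)[of r'] that by (auto simp: is_root_def elim: rtranclE)
  then show ?thesis
    unfolding tree_root_def using assms(2) q(1) by (metis the_equality)
qed

lemma tree_root:
  assumes "rooted_tree t"
  shows "is_root t (tree_root t)" "tree_root t \<in> verts t"
    and "v \<in> verts t \<Longrightarrow> (tree_root t, v) \<in> (edges t)\<^sup>*"
proof -
  obtain r where "is_root t r" "\<And>v. v \<in> verts t \<Longrightarrow> (r, v) \<in> (edges t)\<^sup>*"
    using assms by (auto simp: rooted_tree_def)
  moreover from this have "tree_root t = r"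
    using assms by (intro tree_root_eqI)
  ultimately show "is_root t (tree_root t)" "tree_root t \<in> verts t"
    and "v \<in> verts t \<Longrightarrow> (tree_root t, v) \<in> (edges t)\<^sup>*"
    by (auto simp: is_root_def)
qed

lemma reachable_in_verts:
  assumes "edges g \<subseteq> verts g \<times> verts g" "(v, w) \<in> (edges g)\<^sup>*" "v \<in> verts g"
  shows "w \<in> verts g"
  using assms(2,3,1) by (induction rule: rtrancl_induct) auto

text \<open>Every vertex on a path from \<open>r\<close> is itself a descendant of \<open>r\<close>,
  so such paths survive the restriction to the descendants.\<close>

lemma rooted_tree_component:
  assumes fin: "finite (verts g)" and sub: "edges g \<subseteq> verts g \<times> verts g"
    and uniq: "\<And>u u' v. (u, v) \<in> edges g \<Longrightarrow> (u', v) \<in> edges g \<Longrightarrow> u = u'"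
    and r: "is_root g r"
  shows "rooted_tree (induced g ((edges g)\<^sup>* `` {r}))" (is "rooted_tree ?c")
proof -
  have "(edges g)\<^sup>* `` {r} \<subseteq> verts g"
    using reachable_in_verts[OF sub] r by (auto simp: is_root_def)
  then have "finite (verts ?c)"
    using fin by (auto simp: induced_def intro: finite_subset)
  moreover have "is_root ?c r"
    using r by (auto simp: is_root_def induced_def)
  moreover have "(r, v) \<in> (edges ?c)\<^sup>*" if "(r, v) \<in> (edges g)\<^sup>*" for v
    using that
  proof (induction rule: rtrancl_induct)
    case (step y z)
    then have "(y, z) \<in> edges ?c"
      by (auto simp: induced_def intro: rtrancl_into_rtrancl)
    with step.IH show ?case
      by (rule rtrancl_into_rtrancl)
  qed simp
  ultimately show ?thesis
    using uniq unfolding rooted_tree_def by (auto simp: induced_def)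
qed

text \<open>Trades the decomposition into disjoint trees for conditions that can be checked vertex
  by vertex in grafts and induced subgraphs. By disjointness, every edge into a vertex lies in the
  tree of that vertex, so parents and roots are determined tree by tree.\<close>

lemma rooted_forest_iff:
  "rooted_forest g \<longleftrightarrow>
     finite (verts g) \<and> edges g \<subseteq> verts g \<times> verts g \<and>
     (\<forall>u u' v. (u, v) \<in> edges g \<longrightarrow> (u', v) \<in> edges g \<longrightarrow> u = u') \<and>
     (\<forall>v\<in>verts g. \<exists>r. is_root g r \<and> (r, v) \<in> (edges g)\<^sup>*)" (is "_ \<longleftrightarrow> ?R")
proof
  assume "rooted_forest g"
  then obtain F where "finite F \<and> (\<forall>t\<in>F. rooted_tree t) \<and>
      (\<forall>t\<in>F. \<forall>t'\<in>F. t \<noteq> t' \<longrightarrow> verts t \<inter> verts t' = {}) \<and>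
      g = RGraph (\<Union>t\<in>F. verts t) (\<Union>t\<in>F. edges t)"
    unfolding rooted_forest_def by (rule exE)
  then have F: "finite F" "\<And>t. t \<in> F \<Longrightarrow> rooted_tree t"
      "\<And>t t'. t \<in> F \<Longrightarrow> t' \<in> F \<Longrightarrow> t \<noteq> t' \<Longrightarrow> verts t \<inter> verts t' = {}"
    and g: "g = RGraph (\<Union>t\<in>F. verts t) (\<Union>t\<in>F. edges t)"
    by simp_all
  have sub: "u \<in> verts t \<and> v \<in> verts t" if "t \<in> F" "(u, v) \<in> edges t" for t u v
    using edges_tree[OF F(2)] that by blast
  have same: "t = t'" if "t \<in> F" "t' \<in> F" "v \<in> verts t" "v \<in> verts t'" for t t' v
    using F(3)[of t t'] that by blast
  have vg: "verts g = (\<Union>t\<in>F. verts t)" and eg: "edges g = (\<Union>t\<in>F. edges t)"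
    by (simp_all add: g)
  have "finite (verts g)"
    using F by (simp add: vg rooted_tree_def)
  moreover have "edges g \<subseteq> verts g \<times> verts g"
    using sub unfolding vg eg by fast
  moreover have "u = u'" if uv: "(u, v) \<in> edges g" "(u', v) \<in> edges g" for u u' v
  proof -
    obtain t t' where t: "t \<in> F" "(u, v) \<in> edges t" "t' \<in> F" "(u', v) \<in> edges t'"
      using uv unfolding eg by blast
    then have "t = t'"
      using same[of t t' v] sub[of t u v] sub[of t' u' v] by simp
    then show ?thesis
      using t F(2)[of t] by (auto simp: rooted_tree_def)
  qed
  moreover have "\<exists>r. is_root g r \<and> (r, v) \<in> (edges g)\<^sup>*" if v: "v \<in> verts g" for v
  proof -
    obtain t where t: "t \<in> F" "v \<in> verts t"
      using v unfolding vg by blast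
    note rt = tree_root[OF F(2)[OF t(1)]]
    \<comment> \<open>The tree containing such an edge would share a vertex with \<open>t\<close>,
      hence would be \<open>t\<close> itself.\<close>
    have "(u, tree_root t) \<notin> edges g" for u
    proof
      assume "(u, tree_root t) \<in> edges g"
      then obtain t' where t': "t' \<in> F" "(u, tree_root t) \<in> edges t'"
        unfolding eg by blast
      then have "t' = t"
        using same[of t' t "tree_root t"] sub[of t' u "tree_root t"] t(1) rt(2) by simp
      then show False
        using t' rt(1) by (auto simp: is_root_def)
    qed
    then have "is_root g (tree_root t)"
      using rt(2) t(1) unfolding is_root_def vg by blast
    moreover have "(edges t)\<^sup>* \<subseteq> (edges g)\<^sup>*"
      using t(1) by (intro rtrancl_mono) (auto simp: eg)
    ultimately show ?thesis
      using rt(3) t(2) by blast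
  qed
  ultimately show ?R
    by blast
next
  assume R: ?R
  then have fin: "finite (verts g)" and sub: "edges g \<subseteq> verts g \<times> verts g"
    and uniq: "\<And>u u' v. (u, v) \<in> edges g \<Longrightarrow> (u', v) \<in> edges g \<Longrightarrow> u = u'"
    and reach: "\<And>v. v \<in> verts g \<Longrightarrow> \<exists>r. is_root g r \<and> (r, v) \<in> (edges g)\<^sup>*"
    by blast+
  \<comment> \<open>The trees of the forest are the sets of descendants of the roots;
    \<open>root_unique\<close> makes them disjoint.\<close>
  define comp where "comp r = induced g ((edges g)\<^sup>* `` {r})" for r
  define F where "F = comp ` {r. is_root g r}"
  have "{r. is_root g r} \<subseteq> verts g"
    by (auto simp: is_root_def)
  then have "finite F"
    unfolding F_def using fin finite_subset by blast
  moreover have "rooted_tree t" if "t \<in> F" for t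
    using that rooted_tree_component[OF fin sub uniq] by (auto simp: F_def comp_def)
  moreover have "verts t \<inter> verts t' = {}" if "t \<in> F" "t' \<in> F" "t \<noteq> t'" for t t'
    using that root_unique[OF uniq] by (fastforce simp: F_def comp_def induced_def)
  moreover have "g = RGraph (\<Union>t\<in>F. verts t) (\<Union>t\<in>F. edges t)"
  proof (rule rgraph.expand, intro conjI)
    show "verts g = verts (RGraph (\<Union>t\<in>F. verts t) (\<Union>t\<in>F. edges t))"
      using reach reachable_in_verts[OF sub]
      by (fastforce simp: F_def comp_def induced_def is_root_def)
    have "(u, v) \<in> (\<Union>t\<in>F. edges t)" if uv: "(u, v) \<in> edges g" for u v
    proof -
      obtain r where r: "is_root g r" "(r, u) \<in> (edges g)\<^sup>*"
        using reach sub uv by blast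
      with uv have "(r, v) \<in> (edges g)\<^sup>*"
        by (auto intro: rtrancl_into_rtrancl)
      with r uv show ?thesis
        by (auto simp: F_def comp_def induced_def)
    qed
    then show "edges g = edges (RGraph (\<Union>t\<in>F. verts t) (\<Union>t\<in>F. edges t))"
      by (auto simp: F_def comp_def induced_def)
  qed
  ultimately show "rooted_forest g"
    unfolding rooted_forest_def by (intro exI[of _ F] conjI ballI impI)
qed

lemma rooted_forest_tree: "rooted_tree t \<Longrightarrow> rooted_forest t"
  unfolding rooted_forest_iff rooted_tree_def by blast

text \<open>A path from a root of \<open>g\<close> never leaves \<open>W\<close> once it is inside.
  The vertex at which it enters \<open>W\<close> becomes a root of the induced graph, because its
  only parent lies outside.\<close>

lemma rooted_forest_induced:
  assumes g: "rooted_forest g" and W: "W \<subseteq> verts g"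
    and closed: "\<And>u v. (u, v) \<in> edges g \<Longrightarrow> u \<in> W \<Longrightarrow> v \<in> W"
  shows "rooted_forest (induced g W)"
proof -
  have fin: "finite (verts g)"
    and uniq: "\<And>u u' v. (u, v) \<in> edges g \<Longrightarrow> (u', v) \<in> edges g \<Longrightarrow> u = u'"
    and reach: "\<And>v. v \<in> verts g \<Longrightarrow> \<exists>r. is_root g r \<and> (r, v) \<in> (edges g)\<^sup>*"
    using g unfolding rooted_forest_iff by blast+
  have "\<exists>r. is_root (induced g W) r \<and> (r, v) \<in> (edges (induced g W))\<^sup>*" if "v \<in> W" for v
  proof -
    obtain r where "is_root g r" and "(r, v) \<in> (edges g)\<^sup>*"
      using reach W \<open>v \<in> W\<close> by blast
    from this(2) \<open>v \<in> W\<close> show ?thesis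
    proof (induction rule: rtrancl_induct)
      case base
      then show ?case
        using \<open>is_root g r\<close> by (auto simp: is_root_def induced_def)
    next
      case (step y z)
      show ?case
      proof (cases "y \<in> W")
        case True
        then have "(y, z) \<in> edges (induced g W)"
          using step by (auto simp: induced_def)
        with step.IH[OF True] show ?thesis
          by (blast intro: rtrancl_into_rtrancl)
      next
        case False
        then have "is_root (induced g W) z"
          using step uniq by (auto simp: is_root_def induced_def)
        then show ?thesis
          by blast
      qed
    qed
  qed
  then show ?thesis
    using fin W uniq unfolding rooted_forest_iff
    by (auto simp: induced_def intro: finite_subset)
qed

section \<open>Prunings as induced subgraphs closed under children\<close>

lemma path_edges_Cons [simp]: "path_edges (u # v # p) = insert (u, v) (path_edges (v # p))"
  by (simp add: path_edges_def)

lemma path_edges_single [simp]: "path_edges [u] = {}"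
  by (simp add: path_edges_def)

text \<open>A path can cross from outside into \<open>W\<close> only once, as it cannot come out
  again. The first conjunct carries the induction: behind a crossing edge no further edge of
  \<open>C\<close> occurs.\<close>

lemma card_boundary_path:
  assumes closed: "\<And>u v. (u, v) \<in> E \<Longrightarrow> u \<in> W \<Longrightarrow> v \<in> W"
    and C: "\<And>u v. (u, v) \<in> C \<Longrightarrow> u \<notin> W \<and> v \<in> W"
    and "p \<noteq> []" "successively (\<lambda>u v. (u, v) \<in> E) p"
  shows "(hd p \<in> W \<longrightarrow> C \<inter> path_edges p = {}) \<and> card (C \<inter> path_edges p) \<le> 1"
  using assms(3,4)
proof (induction p rule: induct_list012)
  case (3 u v p)
  have uv: "(u, v) \<in> E" and IH: "v \<in> W \<Longrightarrow> C \<inter> path_edges (v # p) = {}"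
    "card (C \<inter> path_edges (v # p)) \<le> 1"
    using 3 by auto
  show ?case
  proof (cases "(u, v) \<in> C")
    case True
    then show ?thesis
      using C[OF True] IH(1) by simp
  next
    case False
    then show ?thesis
      using closed[OF uv] IH by simp
  qed
qed auto

text \<open>The cut belonging to \<open>W\<close> consists of the edges entering \<open>W\<close>; it is total if \<open>W\<close>
  contains the root.\<close>

lemma is_couple_iff:
  "is_couple (t, s) \<longleftrightarrow> rooted_tree t \<and>
     (\<exists>W \<subseteq> verts t. (\<forall>u v. (u, v) \<in> edges t \<longrightarrow> u \<in> W \<longrightarrow> v \<in> W) \<and> s = induced t W)"
  (is "_ \<longleftrightarrow> _ \<and> (\<exists>W \<subseteq> verts t. ?closed W \<and> _)")
proof
  assume "is_couple (t, s)"
  then obtain c where t: "rooted_tree t" and c: "admissible_cut t c" "s = pruning t c"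
    by (auto simp: is_couple_def)
  have sub: "edges t \<subseteq> verts t \<times> verts t"
    using edges_tree[OF t] .
  have "\<exists>W \<subseteq> verts t. ?closed W \<and> s = induced t W"
  proof (cases c)
    case Total_Cut
    then have "s = induced t (verts t)"
      using c sub by (cases t) (auto simp: induced_def)
    then show ?thesis
      using sub by blast
  next
    case (Edge_Cut C)
    let ?W = "{w. \<exists>(u, v)\<in>C. (v, w) \<in> (edges t)\<^sup>*}"
    have "s = induced t ?W"
      using c Edge_Cut by simp
    moreover have "?W \<subseteq> verts t"
      using pruning_subgraph(1)[OF t c(1)] Edge_Cut by (simp add: induced_def)
    moreover have "?closed ?W"
      by (auto intro: rtrancl_into_rtrancl)
    ultimately show ?thesis
      by blast
  qed
  with t show "rooted_tree t \<and> (\<exists>W \<subseteq> verts t. ?closed W \<and> s = induced t W)"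
    by blast
next
  assume "rooted_tree t \<and> (\<exists>W \<subseteq> verts t. ?closed W \<and> s = induced t W)"
  then obtain W where t: "rooted_tree t" and W: "W \<subseteq> verts t" "?closed W"
    and s: "s = induced t W"
    by blast
  have sub: "edges t \<subseteq> verts t \<times> verts t"
    using edges_tree[OF t] .
  have reach_W: "w \<in> W" if "(v, w) \<in> (edges t)\<^sup>*" "v \<in> W" for v w
    using that W(2) by (induction rule: rtrancl_induct) auto
  show "is_couple (t, s)"
  proof (cases "tree_root t \<in> W")
    case True
    \<comment> \<open>All vertices are descendants of the root, and \<open>W\<close> is closed under
      children.\<close>
    then have "W = verts t"
      using W(1) reach_W tree_root(3)[OF t] by blast
    then have "s = pruning t Total_Cut"
      using sub by (cases t) (auto simp: s induced_def)
    with t show ?thesis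
      unfolding is_couple_def by (auto intro!: exI[of _ Total_Cut])
  next
    case False
    define C where "C = {(u, v). (u, v) \<in> edges t \<and> u \<notin> W \<and> v \<in> W}"
    have "card (C \<inter> path_edges p) \<le> 1" if "root_leaf_path t p" for p
      using card_boundary_path[of "edges t" W C p] W(2) that
      unfolding C_def root_leaf_path_def by blast
    then have "admissible_cut t (Edge_Cut C)"
      by (auto simp: C_def)
    moreover have "w \<in> W \<longleftrightarrow> (\<exists>(u, v)\<in>C. (v, w) \<in> (edges t)\<^sup>*)" for w
    proof
      \<comment> \<open>The path from the root to \<open>w\<close> starts outside \<open>W\<close>,
        so it enters \<open>W\<close> along an edge of \<open>C\<close>.\<close>
      assume "w \<in> W"
      then have "(tree_root t, w) \<in> (edges t)\<^sup>*"
        using W(1) tree_root(3)[OF t] by blast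
      then show "\<exists>(u, v)\<in>C. (v, w) \<in> (edges t)\<^sup>*"
        using \<open>w \<in> W\<close>
      proof (induction rule: rtrancl_induct)
        case base
        then show ?case
          using False by simp
      next
        case (step y z)
        show ?case
        proof (cases "y \<in> W")
          case True
          then show ?thesis
            using step by (blast intro: rtrancl_into_rtrancl)
        next
          case False
          then have "(y, z) \<in> C"
            using step by (simp add: C_def)
          then show ?thesis
            by blast
        qed
      qed
    next
      assume "\<exists>(u, v)\<in>C. (v, w) \<in> (edges t)\<^sup>*"
      then show "w \<in> W"
        using reach_W by (auto simp: C_def)
    qed
    then have "W = {w. \<exists>(u, v)\<in>C. (v, w) \<in> (edges t)\<^sup>*}"
      by blast
    ultimately show ?thesis
      using t s unfolding is_couple_def by (auto intro!: exI[of _ "Edge_Cut C"])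
  qed
qed

lemma rooted_forest_couple: "is_couple (t, s) \<Longrightarrow> rooted_forest s"
  unfolding is_couple_iff using rooted_forest_induced[OF rooted_forest_tree] by metis

lemma couple_subgraph:
  assumes "is_couple (t, s)"
  shows "verts s \<subseteq> verts t"
  using assms by (auto simp: is_couple_iff induced_def)


section \<open>Grafting of graphs\<close>

abbreviation old_vertex :: "nat \<Rightarrow> nat" where
  "old_vertex x \<equiv> sum_encode (Inl x)"

abbreviation new_vertex :: "nat \<Rightarrow> nat" where
  "new_vertex x \<equiv> sum_encode (Inr x)"

lemma verts_graft_at:
  "verts (graft_at t v s) = old_vertex ` verts s \<union> new_vertex ` verts t"
  by (auto simp: graft_at_def Let_def relabel_def)

lemma edges_graft_at:
  "edges (graft_at t v s) =
     map_prod old_vertex old_vertex ` edges s \<union> map_prod new_vertex new_vertex ` edges t \<union>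
     {(old_vertex v, new_vertex (tree_root t))}"
  by (simp add: graft_at_def Let_def relabel_def comp_def)

lemma edges_graft_at_old:
  "(x, y) \<in> edges s \<Longrightarrow> (old_vertex x, old_vertex y) \<in> edges (graft_at t v s)"
  by (force simp: edges_graft_at)

lemma edges_graft_at_new:
  "(x, y) \<in> edges t \<Longrightarrow> (new_vertex x, new_vertex y) \<in> edges (graft_at t v s)"
  by (force simp: edges_graft_at)

lemma rtrancl_image:
  assumes "(x, y) \<in> E\<^sup>*" "map_prod f f ` E \<subseteq> E'"
  shows "(f x, f y) \<in> E'\<^sup>*"
  using assms(1)
proof (induction rule: rtrancl_induct)
  case (step y z)
  then have "(f y, f z) \<in> E'"
    using assms(2) by force
  with step.IH show ?case
    by (rule rtrancl_into_rtrancl)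
qed simp

text \<open>The only edge joining the two parts ends in a new vertex, so no old vertex gains a
  parent.\<close>

lemma is_root_graft_at: "is_root s r \<Longrightarrow> is_root (graft_at t v s) (old_vertex r)"
  by (auto simp: is_root_def verts_graft_at edges_graft_at sum_encode_eq)

lemma rooted_forest_graft_at:
  assumes t: "rooted_tree t" and s: "rooted_forest s" and v: "v \<in> verts s"
  shows "rooted_forest (graft_at t v s)" (is "rooted_forest ?g")
proof -
  note T = t[unfolded rooted_tree_def] and S = s[unfolded rooted_forest_iff]
  note root = tree_root[OF t]
  have "finite (verts ?g)"
    using S T by (simp add: verts_graft_at)
  moreover have "edges ?g \<subseteq> verts ?g \<times> verts ?g"
    using edges_forest[OF s] edges_tree[OF t] v root(2)
    by (auto simp: verts_graft_at edges_graft_at)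
  \<comment> \<open>The joining edge could only create a second parent for the root of
    \<open>t\<close>, which has no parent in \<open>t\<close>.\<close>
  moreover have "\<forall>u u' w. (u, w) \<in> edges ?g \<longrightarrow> (u', w) \<in> edges ?g \<longrightarrow> u = u'"
  proof (intro allI impI)
    fix u u' w assume "(u, w) \<in> edges ?g" "(u', w) \<in> edges ?g"
    then show "u = u'"
      using S T root(1)
      by (auto simp: edges_graft_at sum_encode_eq is_root_def)
  qed
  moreover have "\<exists>r. is_root ?g r \<and> (r, w) \<in> (edges ?g)\<^sup>*" if "w \<in> verts ?g" for w
  proof -
    have old: "\<exists>r. is_root ?g r \<and> (r, old_vertex x) \<in> (edges ?g)\<^sup>*" if x: "x \<in> verts s" for x
    proof -
      obtain r where r: "is_root s r" "(r, x) \<in> (edges s)\<^sup>*"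
        using S x by blast
      have "(old_vertex r, old_vertex x) \<in> (edges ?g)\<^sup>*"
        by (rule rtrancl_image[OF r(2)]) (auto simp: edges_graft_at)
      then show ?thesis
        using is_root_graft_at[OF r(1)] by blast
    qed
    have "\<exists>r. is_root ?g r \<and> (r, new_vertex x) \<in> (edges ?g)\<^sup>*" if x: "x \<in> verts t" for x
    proof -
      \<comment> \<open>The whole grafted tree hangs below the root that lies above
        \<open>v\<close>.\<close>
      obtain r where r: "is_root ?g r" "(r, old_vertex v) \<in> (edges ?g)\<^sup>*"
        using old[OF v] by blast
      have "(old_vertex v, new_vertex (tree_root t)) \<in> edges ?g"
        by (simp add: edges_graft_at)
      moreover have "(new_vertex (tree_root t), new_vertex x) \<in> (edges ?g)\<^sup>*"
        by (rule rtrancl_image[OF root(3)[OF x]]) (auto simp: edges_graft_at)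
      ultimately have "(r, new_vertex x) \<in> (edges ?g)\<^sup>*"
        using r(2) by (meson rtrancl_into_rtrancl rtrancl_trans)
      then show ?thesis
        using r(1) by blast
    qed
    with old that show ?thesis
      by (auto simp: verts_graft_at)
  qed
  ultimately show ?thesis
    unfolding rooted_forest_iff by blast
qed

lemma rooted_tree_forest_unique_root:
  assumes "rooted_forest g" "is_root g r" "\<And>r'. is_root g r' \<Longrightarrow> r' = r"
  shows "rooted_tree g"
  using assms unfolding rooted_forest_iff rooted_tree_def by metis

text \<open>The graft is a forest already, so it remains to exclude a second root. A new vertex that
  is a root would be the root of \<open>t\<close>, but this one has the parent
  \<open>old_vertex v\<close>; an old vertex that is a root is the root of \<open>s\<close>.\<close>

lemma
  assumes t: "rooted_tree t" and s: "rooted_tree s" and v: "v \<in> verts s"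
  shows rooted_tree_graft_at: "rooted_tree (graft_at t v s)" (is "rooted_tree ?g")
    and tree_root_graft_at: "tree_root (graft_at t v s) = old_vertex (tree_root s)"
proof -
  have root: "is_root ?g (old_vertex (tree_root s))"
    by (rule is_root_graft_at[OF tree_root(1)[OF s]])
  moreover have "r = old_vertex (tree_root s)" if r: "is_root ?g r" for r
  proof -
    have "r \<in> old_vertex ` verts s"
    proof (rule ccontr)
      assume "r \<notin> old_vertex ` verts s"
      then obtain x where x: "r = new_vertex x" "x \<in> verts t"
        using r by (auto simp: is_root_def verts_graft_at)
      have "is_root t x"
        using r x edges_graft_at_new by (fastforce simp: is_root_def)
      then have "x = tree_root t"
        using tree_root_eqI[OF t] by simp
      then show False
        using r x by (auto simp: is_root_def edges_graft_at)
    qed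
    then obtain x where x: "r = old_vertex x" "x \<in> verts s"
      by blast
    have "is_root s x"
      using r x edges_graft_at_old by (fastforce simp: is_root_def)
    then show ?thesis
      using x(1) tree_root_eqI[OF s] by simp
  qed
  ultimately show tree: "rooted_tree ?g"
    by (rule rooted_tree_forest_unique_root
          [OF rooted_forest_graft_at[OF t rooted_forest_tree[OF s] v]])
  show "tree_root ?g = old_vertex (tree_root s)"
    using tree_root_eqI[OF tree root] .
qed

lemma is_couple_graft_at:
  assumes a: "rooted_tree a" and ts: "is_couple (t, s)" and v: "v \<in> verts s"
  shows "is_couple (graft_at a v t, graft_at a v s)"
proof -
  obtain W where t: "rooted_tree t" and W: "W \<subseteq> verts t"
      "\<And>u v. (u, v) \<in> edges t \<Longrightarrow> u \<in> W \<Longrightarrow> v \<in> W" and s: "s = induced t W"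
    using ts by (auto simp: is_couple_iff)
  have vW: "v \<in> W"
    using v by (simp add: s induced_def)
  \<comment> \<open>The pruned part grows by the entire grafted tree. No edge leads from a new
    vertex to an old one, so closure persists, and the joining edge survives the restriction because
    \<open>v\<close> lies in \<open>W\<close>.\<close>
  let ?W = "old_vertex ` W \<union> new_vertex ` verts a"
  have "rooted_tree (graft_at a v t)"
    using rooted_tree_graft_at[OF a t] W(1) vW by blast
  moreover have "?W \<subseteq> verts (graft_at a v t)"
    using W(1) by (auto simp: verts_graft_at)
  moreover have "\<forall>u w. (u, w) \<in> edges (graft_at a v t) \<longrightarrow> u \<in> ?W \<longrightarrow> w \<in> ?W"
    using W edges_tree[OF a] tree_root(2)[OF a]
    by (auto simp: edges_graft_at sum_encode_eq)
  moreover have "graft_at a v s = induced (graft_at a v t) ?W"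
  proof (rule rgraph.expand, intro conjI)
    show "verts (graft_at a v s) = verts (induced (graft_at a v t) ?W)"
      by (simp add: verts_graft_at s induced_def)
    show "edges (graft_at a v s) = edges (induced (graft_at a v t) ?W)"
      using edges_tree[OF a] tree_root(2)[OF a] vW
      by (auto simp: edges_graft_at s induced_def sum_encode_eq)
  qed
  ultimately show ?thesis
    unfolding is_couple_iff by blast
qed


section \<open>Isomorphisms between iterated graftings\<close>

text \<open>In this form \<open>f\<close> is applied to encoded vertices only, so that maps defined
  by cases on the encoding are evaluated by simplification.\<close>

lemma relabel_graft_at:
  "relabel f (graft_at t v s) =
     RGraph ((\<lambda>x. f (old_vertex x)) ` verts s \<union> (\<lambda>x. f (new_vertex x)) ` verts t)
       ((\<lambda>(x, y). (f (old_vertex x), f (old_vertex y))) ` edges s \<union>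
        (\<lambda>(x, y). (f (new_vertex x), f (new_vertex y))) ` edges t \<union>
        {(f (old_vertex v), f (new_vertex (tree_root t)))})"
  by (simp add: relabel_def verts_graft_at edges_graft_at image_Un image_image map_prod_def
      split_beta)

lemma relabel_is_root:
  assumes "inj_on f (verts t)" "edges t \<subseteq> verts t \<times> verts t" "is_root t r"
  shows "is_root (relabel f t) (f r)"
  using assms by (auto simp: is_root_def relabel_def inj_on_def)

lemma tree_root_relabel:
  assumes "rooted_tree t" "rooted_tree (relabel f t)" "inj_on f (verts t)"
  shows "tree_root (relabel f t) = f (tree_root t)"
  using tree_root_eqI[OF assms(2)] relabel_is_root[OF assms(3) edges_tree[OF assms(1)]]
    tree_root(1)[OF assms(1)] by blast

text \<open>Glues a map on the old vertices and a map on the new vertices of a graft; nested uses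
  give maps on iterated grafts.\<close>

definition vertex_map :: "(nat \<Rightarrow> nat) \<Rightarrow> (nat \<Rightarrow> nat) \<Rightarrow> nat \<Rightarrow> nat" where
  "vertex_map f g x = (case sum_decode x of Inl y \<Rightarrow> f y | Inr y \<Rightarrow> g y)"

lemma vertex_map_simps [simp]:
  "vertex_map f g (old_vertex x) = f x" "vertex_map f g (new_vertex x) = g x"
  by (simp_all add: vertex_map_def)

text \<open>The maps \<open>k\<close> and \<open>f\<close> act side by side on the old and the new
  vertices. One glued map relabels the grafts on \<open>g\<close> and on \<open>h\<close> alike, as
  an isomorphism of couples requires.\<close>

lemma couple_iso_graft_at:
  assumes t: "rooted_tree t" "rooted_tree (relabel f t)" "inj_on f (verts t)"
    and g: "inj_on k (verts g)"
  shows "couple_iso (graft_at t v g, graft_at t v h)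
     (graft_at (relabel f t) (k v) (relabel k g), graft_at (relabel f t) (k v) (relabel k h))"
proof -
  define F where "F = vertex_map (\<lambda>x. old_vertex (k x)) (\<lambda>x. new_vertex (f x))"
  have "inj_on F (verts (graft_at t v g))"
  proof (rule inj_onI)
    fix x y assume "x \<in> verts (graft_at t v g)" "y \<in> verts (graft_at t v g)" "F x = F y"
    then show "x = y"
      unfolding F_def verts_graft_at
      by (elim UnE imageE) (simp_all add: sum_encode_eq inj_on_eq_iff[OF t(3)] inj_on_eq_iff[OF g])
  qed
  moreover have "relabel F (graft_at t v s) = graft_at (relabel f t) (k v) (relabel k s)" for s
    by (rule rgraph.expand)
      (simp add: relabel_graft_at F_def verts_graft_at edges_graft_at tree_root_relabel[OF t],
        simp add: relabel_def image_image map_prod_def split_beta)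
  ultimately show ?thesis
    by (auto simp: couple_iso_def)
qed

text \<open>Both trees are attached to vertices of the original graph. The order of the graftings is
  visible only in the encoding of the vertices.\<close>

lemma couple_iso_graft_at_commute:
  "couple_iso
     (graft_at t1 (old_vertex u) (graft_at t2 v g), graft_at t1 (old_vertex u) (graft_at t2 v h))
     (graft_at t2 (old_vertex v) (graft_at t1 u g), graft_at t2 (old_vertex v) (graft_at t1 u h))"
proof -
  \<comment> \<open>Original vertices keep their double encoding. Those of \<open>t2\<close> become
    the outermost new ones, and those of \<open>t1\<close> move to the inner graft.\<close>
  define F where "F = vertex_map
    (vertex_map (\<lambda>x. old_vertex (old_vertex x)) new_vertex) (\<lambda>x. old_vertex (new_vertex x))"
  have "inj_on F (verts (graft_at t1 (old_vertex u) (graft_at t2 v g)))"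
    by (auto simp: F_def verts_graft_at sum_encode_eq inj_on_def)
  moreover have "relabel F (graft_at t1 (old_vertex u) (graft_at t2 v s)) =
      graft_at t2 (old_vertex v) (graft_at t1 u s)" for s
    by (rule rgraph.expand)
      (simp add: relabel_graft_at F_def verts_graft_at edges_graft_at image_Un image_image
        map_prod_def split_beta Un_ac insert_commute)
  ultimately show ?thesis
    by (auto simp: couple_iso_def)
qed

text \<open>Since \<open>u\<close> belongs to \<open>t2\<close>, only the bracketing of the two
  graftings changes. By \<open>tree_root_graft_at\<close> the composite tree has the root of
  \<open>t2\<close>, so the edge leaving \<open>v\<close> is the same on both sides.\<close>

lemma couple_iso_graft_at_assoc:
  assumes "rooted_tree t1" "rooted_tree t2" "u \<in> verts t2"
  shows "couple_iso
     (graft_at t1 (new_vertex u) (graft_at t2 v g), graft_at t1 (new_vertex u) (graft_at t2 v h))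
     (graft_at (graft_at t1 u t2) v g, graft_at (graft_at t1 u t2) v h)"
proof -
  define F where "F = vertex_map
    (vertex_map old_vertex (\<lambda>x. new_vertex (old_vertex x))) (\<lambda>x. new_vertex (new_vertex x))"
  have "inj_on F (verts (graft_at t1 (new_vertex u) (graft_at t2 v g)))"
    by (auto simp: F_def verts_graft_at sum_encode_eq inj_on_def)
  moreover have "relabel F (graft_at t1 (new_vertex u) (graft_at t2 v s)) =
      graft_at (graft_at t1 u t2) v s" for s
    by (rule rgraph.expand)
      (simp add: relabel_graft_at F_def verts_graft_at edges_graft_at image_Un image_image
        map_prod_def split_beta Un_ac insert_commute tree_root_graft_at[OF assms])
  ultimately show ?thesis
    by (auto simp: couple_iso_def)
qed


section \<open>Linear extensions\<close>

lemma lookup_vscale [simp]: "Poly_Mapping.lookup (vscale c p) b = c * Poly_Mapping.lookup p b"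
  by (simp add: vscale_def Poly_Mapping.map.rep_eq when_def)

lemma vector_space_vscale: "vector_space vscale"
  by unfold_locales (auto intro!: poly_mapping_eqI simp: lookup_add algebra_simps)

interpretation vscale: vector_space vscale
  by (rule vector_space_vscale)

lemma linear_vscale_iff:
  "Vector_Spaces.linear vscale vscale f \<longleftrightarrow>
     (\<forall>p q. f (p + q) = f p + f q) \<and> (\<forall>c p. f (vscale c p) = vscale c (f p))"
  by (auto simp: Vector_Spaces.linear_iff vector_space_vscale)

text \<open>Provides a common index set for vectors of different support: cancellation, or scaling
  by 0, can make a support shrink.\<close>

lemma lin_ext_superset:
  assumes "finite A" "Poly_Mapping.keys p \<subseteq> A"
  shows "lin_ext f p = (\<Sum>a\<in>A. vscale (Poly_Mapping.lookup p a) (f a))"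
  unfolding lin_ext_def using assms
  by (intro sum.mono_neutral_left) (auto simp: in_keys_iff)

lemma lin_ext_add: "lin_ext f (p + q) = lin_ext f p + lin_ext f q"
proof -
  let ?A = "Poly_Mapping.keys p \<union> Poly_Mapping.keys q"
  have "lin_ext f x = (\<Sum>a\<in>?A. vscale (Poly_Mapping.lookup x a) (f a))"
    if "x \<in> {p, q, p + q}" for x
    using that Poly_Mapping.keys_add[of p q] by (intro lin_ext_superset) auto
  then show ?thesis
    by (simp add: lookup_add vscale.scale_left_distrib sum.distrib)
qed

lemma lin_ext_vscale: "lin_ext f (vscale c p) = vscale c (lin_ext f p)"
proof -
  have "lin_ext f x = (\<Sum>a\<in>Poly_Mapping.keys p. vscale (Poly_Mapping.lookup x a) (f a))"
    if "x \<in> {p, vscale c p}" for x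
    using that by (intro lin_ext_superset) (auto simp: in_keys_iff)
  then show ?thesis
    by (simp add: vscale.scale_sum_right)
qed

lemma linear_lin_ext: "Vector_Spaces.linear vscale vscale (lin_ext f)"
  by (simp add: linear_vscale_iff lin_ext_add lin_ext_vscale)

lemma lin_ext_basis_vec [simp]: "lin_ext f (basis_vec b) = f b"
  by (simp add: lin_ext_def basis_vec_def)

lemma lin_ext_add_fun: "lin_ext (\<lambda>a. f a + g a) p = lin_ext f p + lin_ext g p"
  by (simp add: lin_ext_def vscale.scale_right_distrib sum.distrib)

lemma lin_ext_vscale_fun: "lin_ext (\<lambda>a. vscale c (f a)) p = vscale c (lin_ext f p)"
  by (simp add: lin_ext_def vscale.scale_sum_right mult.commute)

lemma linear_on_basis:
  assumes "Vector_Spaces.linear vscale vscale f"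
  shows "f p = lin_ext (\<lambda>b. f (basis_vec b)) p"
proof -
  interpret f: Vector_Spaces.linear vscale vscale f
    by (rule assms)
  have "p = (\<Sum>a\<in>Poly_Mapping.keys p. vscale (Poly_Mapping.lookup p a) (basis_vec a))"
    by (rule poly_mapping_eqI)
      (simp add: lookup_sum basis_vec_def lookup_single when_def in_keys_iff if_distrib
        cong: if_cong)
  then have "f p = f (\<Sum>a\<in>Poly_Mapping.keys p. vscale (Poly_Mapping.lookup p a) (basis_vec a))"
    by simp
  then show ?thesis
    by (simp add: f.sum f.scale lin_ext_def)
qed

lemma linear_eq_on_basis:
  assumes "Vector_Spaces.linear vscale vscale f" "Vector_Spaces.linear vscale vscale g"
    and "\<And>b. f (basis_vec b) = g (basis_vec b)"
  shows "f p = g p"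
proof -
  have "f p = lin_ext (\<lambda>b. f (basis_vec b)) p"
    using assms(1) by (rule linear_on_basis)
  also have "\<dots> = lin_ext (\<lambda>b. g (basis_vec b)) p"
    by (simp only: assms(3))
  also have "\<dots> = g p"
    using assms(2) by (rule linear_on_basis[symmetric])
  finally show ?thesis .
qed

lemma bilin_ext_basis_vec [simp]: "bilin_ext f (basis_vec a) (basis_vec b) = f a b"
  by (simp add: bilin_ext_def)

lemma bilin_ext_add_left: "bilin_ext f (p + p') q = bilin_ext f p q + bilin_ext f p' q"
  and bilin_ext_vscale_left: "bilin_ext f (vscale c p) q = vscale c (bilin_ext f p q)"
  and bilin_ext_add_right: "bilin_ext f p (q + q') = bilin_ext f p q + bilin_ext f p q'"
  and bilin_ext_vscale_right: "bilin_ext f p (vscale c q) = vscale c (bilin_ext f p q)"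
  by (simp_all add: bilin_ext_def lin_ext_add lin_ext_vscale lin_ext_add_fun lin_ext_vscale_fun)

lemmas bilin_ext_linear =
  bilin_ext_add_left bilin_ext_vscale_left bilin_ext_add_right bilin_ext_vscale_right

lemma bilinear_map_bilin_ext: "bilinear_map vscale vscale vscale (bilin_ext f)"
  by (simp add: bilinear_map_def linear_vscale_iff bilin_ext_linear)

lemma bilin_ext_sum_left:
  "bilin_ext f (\<Sum>i\<in>I. ps i) q = (\<Sum>i\<in>I. bilin_ext f (ps i) q)"
  and bilin_ext_sum_right:
  "bilin_ext f p (\<Sum>i\<in>I. qs i) = (\<Sum>i\<in>I. bilin_ext f p (qs i))"
proof -
  \<comment> \<open>The value at zero settles sums over empty index sets and over infinite ones,
    which are zero by convention.\<close>
  have zero: "bilin_ext f 0 q = 0" for q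
    using bilin_ext_vscale_left[of f 0 0 q] by simp
  have "bilin_ext f p 0 = 0"
    using bilin_ext_vscale_right[of f p 0 0] by simp
  with zero show "bilin_ext f (\<Sum>i\<in>I. ps i) q = (\<Sum>i\<in>I. bilin_ext f (ps i) q)"
    "bilin_ext f p (\<Sum>i\<in>I. qs i) = (\<Sum>i\<in>I. bilin_ext f p (qs i))"
    by (induction I rule: infinite_finite_induct) (simp_all add: bilin_ext_linear)
qed

text \<open>Both sides of the module identity are trilinear, hence it suffices to check it on basis
  vectors.\<close>

lemma pre_lie_identity_bilin_ext:
  fixes f :: "'a \<Rightarrow> 'm \<Rightarrow> ('m \<Rightarrow>\<^sub>0 'k::field)" and g :: "'a \<Rightarrow> 'a \<Rightarrow> ('a \<Rightarrow>\<^sub>0 'k)"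
  defines "act \<equiv> bilin_ext f" and "mul \<equiv> bilin_ext g"
  assumes basis: "\<And>a b m. act (basis_vec a) (act (basis_vec b) (basis_vec m)) -
      act (mul (basis_vec a) (basis_vec b)) (basis_vec m) =
    act (basis_vec b) (act (basis_vec a) (basis_vec m)) -
      act (mul (basis_vec b) (basis_vec a)) (basis_vec m)"
  shows "act x (act y z) - act (mul x y) z = act y (act x z) - act (mul y x) z"
proof -
  \<comment> \<open>\<open>D\<close> is the associator up to sign; the identity says that it is
    symmetric in its first two arguments.\<close>
  define D where "D x y z = act x (act y z) - act (mul x y) z" for x y z
  have add: "act (p + p') q = act p q + act p' q" "act p (q + q') = act p q + act p q'"
      "mul (s + s') t = mul s t + mul s' t" "mul s (t + t') = mul s t + mul s t'"
      for p p' q q' s s' t t'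
    by (simp_all add: act_def mul_def bilin_ext_linear)
  have scale: "act (vscale c p) q = vscale c (act p q)" "act p (vscale c q) = vscale c (act p q)"
      "mul (vscale c s) t = vscale c (mul s t)" "mul s (vscale c t) = vscale c (mul s t)"
      for c p q s t
    by (simp_all add: act_def mul_def bilin_ext_linear)
  have lin1: "Vector_Spaces.linear vscale vscale (\<lambda>x. D x y z)" for y z
    by (simp add: linear_vscale_iff D_def add scale vscale.scale_right_diff_distrib)
  have lin2: "Vector_Spaces.linear vscale vscale (\<lambda>y. D x y z)" for x z
    by (simp add: linear_vscale_iff D_def add scale vscale.scale_right_diff_distrib)
  have lin3: "Vector_Spaces.linear vscale vscale (D x y)" for x y
    by (simp add: linear_vscale_iff D_def add scale vscale.scale_right_diff_distrib)
  \<comment> \<open>Basis vectors give way to arbitrary vectors one argument at a time, beginning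
    with the third.\<close>
  have 1: "D (basis_vec a) (basis_vec b) z = D (basis_vec b) (basis_vec a) z" for a b
    using linear_eq_on_basis[OF lin3 lin3] basis unfolding D_def by blast
  have 2: "D (basis_vec a) y z = D y (basis_vec a) z" for a
    using linear_eq_on_basis[OF lin2[of "basis_vec a" z] lin1[of "basis_vec a" z], of y] 1
    by blast
  have "D x y z = D y x z"
    using linear_eq_on_basis[OF lin1[of y z] lin2[of y z], of x] 2 by blast
  then show ?thesis
    by (simp add: D_def)
qed


section \<open>The pre-Lie module of a class of pairs of graphs\<close>

lemma rooted_tree_rep: "rooted_tree (rep_rtree a)"
  using Quotient3_rep_reflp[OF Quotient3_rtree, of a] by (simp add: tree_rel_def)

lemma rgraph_iso_rep_abs_rtree: "rooted_tree t \<Longrightarrow> rgraph_iso (rep_rtree (abs_rtree t)) t"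
  using Quotient3_rep_abs[OF Quotient3_rtree, of t] by (simp add: tree_rel_def rgraph_iso_refl)

lemma abs_rtree_rep: "abs_rtree (rep_rtree a) = a"
  by (rule Quotient3_abs_rep[OF Quotient3_rtree])

definition graft_pair ::
    "nat rgraph \<Rightarrow> nat \<Rightarrow> nat rgraph \<times> nat rgraph \<Rightarrow> nat rgraph \<times> nat rgraph" where
  "graft_pair t v = map_prod (graft_at t v) (graft_at t v)"

lemma verts_snd_graft_pair:
  "verts (snd (graft_pair t v x)) = old_vertex ` verts (snd x) \<union> new_vertex ` verts t"
  by (simp add: graft_pair_def verts_graft_at)

text \<open>Trees and forests are treated as the pairs \<open>(t, t)\<close>, so that trees, forests and couples
  are instances of the same construction.\<close>

locale graft_class =
  fixes valid :: "nat rgraph \<times> nat rgraph \<Rightarrow> bool"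
    and ab :: "nat rgraph \<times> nat rgraph \<Rightarrow> 'b"
    and rp :: "'b \<Rightarrow> nat rgraph \<times> nat rgraph"
  assumes valid_rep: "valid (rp b)"
    and abs_rep: "ab (rp b) = b"
    and abs_eq: "valid x \<Longrightarrow> valid y \<Longrightarrow> couple_iso x y \<Longrightarrow> ab x = ab y"
    and rep_abs: "valid x \<Longrightarrow> couple_iso (rp (ab x)) x"
    and finite_valid: "valid x \<Longrightarrow> finite (verts (snd x))"
    and verts_valid: "valid x \<Longrightarrow> verts (snd x) \<subseteq> verts (fst x)"
    and valid_graft: "rooted_tree t \<Longrightarrow> valid x \<Longrightarrow> v \<in> verts (snd x) \<Longrightarrow> valid (graft_pair t v x)"
begin

definition graft_sum :: "nat rgraph \<Rightarrow> nat rgraph \<times> nat rgraph \<Rightarrow> ('b \<Rightarrow>\<^sub>0 'k::field)" where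
  "graft_sum t x = (\<Sum>v\<in>verts (snd x). basis_vec (ab (graft_pair t v x)))"

definition act :: "(rtree \<Rightarrow>\<^sub>0 'k::field) \<Rightarrow> ('b \<Rightarrow>\<^sub>0 'k) \<Rightarrow> ('b \<Rightarrow>\<^sub>0 'k)" where
  "act = bilin_ext (\<lambda>a b. graft_sum (rep_rtree a) (rp b))"

text \<open>Independence of representatives: \<open>k\<close> is a bijection between the vertices of
  the second components, and it matches the sums term by term up to isomorphism.\<close>

lemma graft_sum_cong:
  assumes t: "rooted_tree t" "rooted_tree t'" "rgraph_iso t t'"
    and x: "valid x" "valid y" "couple_iso x y"
  shows "graft_sum t x = graft_sum t' y"
proof -
  obtain f where f: "inj_on f (verts t)" "relabel f t = t'"
    using t(3) by (auto simp: rgraph_iso_def)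
  obtain k where k: "inj_on k (verts (fst x))" "relabel k (fst x) = fst y"
      "relabel k (snd x) = snd y"
    using x(3) by (cases x; cases y) (auto simp: couple_iso_def)
  have verts_y: "verts (snd y) = k ` verts (snd x)"
    using k(3) by (metis verts_relabel)
  have "inj_on k (verts (snd x))"
    using k(1) verts_valid[OF x(1)] by (rule inj_on_subset)
  moreover have "ab (graft_pair t v x) = ab (graft_pair t' (k v) y)" if v: "v \<in> verts (snd x)" for v
  proof (rule abs_eq)
    show "valid (graft_pair t v x)"
      using valid_graft t(1) x(1) v .
    show "valid (graft_pair t' (k v) y)"
      by (rule valid_graft[OF t(2) x(2)]) (simp add: verts_y v)
    have "couple_iso (graft_at t v (fst x), graft_at t v (snd x))
        (graft_at (relabel f t) (k v) (relabel k (fst x)),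
         graft_at (relabel f t) (k v) (relabel k (snd x)))"
      using t f k(1) by (intro couple_iso_graft_at) simp_all
    then show "couple_iso (graft_pair t v x) (graft_pair t' (k v) y)"
      by (simp add: graft_pair_def map_prod_def split_beta f k)
  qed
  ultimately show ?thesis
    unfolding graft_sum_def verts_y by (simp add: sum.reindex)
qed

text \<open>A graft need not be the chosen representative of its class. This allows the action to be
  computed on any valid representative, as iterated actions require.\<close>

lemma act_abs:
  assumes "rooted_tree t" "valid x"
  shows "act (basis_vec (abs_rtree t)) (basis_vec (ab x)) = graft_sum t x"
  unfolding act_def bilin_ext_basis_vec
  by (rule graft_sum_cong)
    (simp_all add: assms rooted_tree_rep valid_rep rgraph_iso_rep_abs_rtree rep_abs)

lemma act_basis_vec:
  "act (basis_vec a) (basis_vec b) = graft_sum (rep_rtree a) (rp b)"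
  by (simp add: act_def)

text \<open>The vertices of a graft are those of the old pair and those of the grafted tree. Grafting
  on the latter gives the term subtracted in the module identity; grafting on the former gives an
  expression that is symmetric in the two trees.\<close>

lemma act_act_diff:
  fixes a b m
  defines "A \<equiv> rep_rtree a" and "B \<equiv> rep_rtree b" and "M \<equiv> rp m"
  shows "act (basis_vec a) (act (basis_vec b) (basis_vec m)) -
      act (graft_tree (basis_vec a) (basis_vec b)) (basis_vec m) =
    (\<Sum>v\<in>verts (snd M). \<Sum>u\<in>verts (snd M).
       basis_vec (ab (graft_pair A (old_vertex u) (graft_pair B v M))))" (is "?l - ?r = ?S")
proof -
  have A: "rooted_tree A" and B: "rooted_tree B" and M: "valid M"
    and abs: "a = abs_rtree A" "b = abs_rtree B" "m = ab M"
    by (simp_all add: A_def B_def M_def rooted_tree_rep valid_rep abs_rtree_rep abs_rep)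
  have fin: "finite (verts (snd M))" "finite (verts B)"
    using finite_valid[OF M] B by (simp_all add: rooted_tree_def)
  have vB: "valid (graft_pair B v M)" if "v \<in> verts (snd M)" for v
    using valid_graft B M that .
  have assoc: "ab (graft_pair A (new_vertex u) (graft_pair B v M)) =
      ab (graft_pair (graft_at A u B) v M)" if "v \<in> verts (snd M)" "u \<in> verts B" for u v
  proof (rule abs_eq)
    show "valid (graft_pair A (new_vertex u) (graft_pair B v M))"
      by (rule valid_graft[OF A vB[OF that(1)]]) (simp add: verts_snd_graft_pair that)
    show "valid (graft_pair (graft_at A u B) v M)"
      using valid_graft rooted_tree_graft_at[OF A B that(2)] M that(1) .
    show "couple_iso (graft_pair A (new_vertex u) (graft_pair B v M))
        (graft_pair (graft_at A u B) v M)"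
      using couple_iso_graft_at_assoc[OF A B that(2)]
      by (simp add: graft_pair_def map_prod_def split_beta)
  qed
  have split: "graft_sum A (graft_pair B v M) =
      (\<Sum>u\<in>verts (snd M). basis_vec (ab (graft_pair A (old_vertex u) (graft_pair B v M)))) +
      (\<Sum>u\<in>verts B. basis_vec (ab (graft_pair (graft_at A u B) v M)))"
    if v: "v \<in> verts (snd M)" for v
  proof -
    let ?e = "\<lambda>w. basis_vec (ab (graft_pair A w (graft_pair B v M)))"
    have "graft_sum A (graft_pair B v M) =
        (\<Sum>w\<in>old_vertex ` verts (snd M) \<union> new_vertex ` verts B. ?e w)"
      by (simp add: graft_sum_def verts_snd_graft_pair)
    also have "\<dots> = (\<Sum>w\<in>old_vertex ` verts (snd M). ?e w) + (\<Sum>w\<in>new_vertex ` verts B. ?e w)"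
      using fin by (intro sum.union_disjoint) (auto simp: sum_encode_eq)
    also have "\<dots> = (\<Sum>u\<in>verts (snd M). ?e (old_vertex u)) + (\<Sum>u\<in>verts B. ?e (new_vertex u))"
      by (simp add: sum.reindex inj_on_def sum_encode_eq)
    also have "(\<Sum>u\<in>verts B. ?e (new_vertex u)) =
        (\<Sum>u\<in>verts B. basis_vec (ab (graft_pair (graft_at A u B) v M)))"
      by (intro sum.cong) (simp_all add: assoc v)
    finally show ?thesis .
  qed
  have "?l = (\<Sum>v\<in>verts (snd M). act (basis_vec a) (basis_vec (ab (graft_pair B v M))))"
    by (simp add: act_basis_vec[of b] graft_sum_def)
      (simp add: act_def bilin_ext_sum_right A_def B_def M_def)
  also have "\<dots> = (\<Sum>v\<in>verts (snd M). graft_sum A (graft_pair B v M))"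
    unfolding abs(1) by (intro sum.cong refl act_abs A vB)
  also have "\<dots> = ?S + (\<Sum>v\<in>verts (snd M). \<Sum>u\<in>verts B.
      basis_vec (ab (graft_pair (graft_at A u B) v M)))"
    by (simp add: split sum.distrib)
  \<comment> \<open>Exchanging the sums groups the terms by the trees that occur in the grafting of
    \<open>a\<close> on \<open>b\<close>.\<close>
  also have "(\<Sum>v\<in>verts (snd M). \<Sum>u\<in>verts B.
      basis_vec (ab (graft_pair (graft_at A u B) v M))) =
    (\<Sum>u\<in>verts B. graft_sum (graft_at A u B) M)"
    unfolding graft_sum_def by (rule sum.swap)
  also have "\<dots> = (\<Sum>u\<in>verts B. act (basis_vec (abs_rtree (graft_at A u B))) (basis_vec m))"
    unfolding abs(3) by (intro sum.cong refl act_abs[symmetric] rooted_tree_graft_at A B M)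
  also have "\<dots> = ?r"
    by (simp add: graft_tree_def act_def bilin_ext_sum_left A_def B_def)
  finally show ?thesis
    by simp
qed

lemma act_pre_lie:
  "act x (act y z) - act (graft_tree x y) z = act y (act x z) - act (graft_tree y x) z"
  unfolding act_def graft_tree_def
proof (rule pre_lie_identity_bilin_ext, fold act_def graft_tree_def)
  fix a b m
  let ?A = "rep_rtree a" and ?B = "rep_rtree b" and ?M = "rp m"
  have comm: "ab (graft_pair ?A (old_vertex u) (graft_pair ?B v ?M)) =
      ab (graft_pair ?B (old_vertex v) (graft_pair ?A u ?M))"
    if uv: "v \<in> verts (snd ?M)" "u \<in> verts (snd ?M)" for u v
  proof (rule abs_eq)
    show "valid (graft_pair ?A (old_vertex u) (graft_pair ?B v ?M))"
      "valid (graft_pair ?B (old_vertex v) (graft_pair ?A u ?M))"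
      using uv by (auto intro!: valid_graft rooted_tree_rep valid_rep simp: verts_snd_graft_pair)
    show "couple_iso (graft_pair ?A (old_vertex u) (graft_pair ?B v ?M))
        (graft_pair ?B (old_vertex v) (graft_pair ?A u ?M))"
      using couple_iso_graft_at_commute
      by (simp add: graft_pair_def map_prod_def split_beta)
  qed
  show "act (basis_vec a) (act (basis_vec b) (basis_vec m)) -
      act (graft_tree (basis_vec a) (basis_vec b)) (basis_vec m) =
    act (basis_vec b) (act (basis_vec a) (basis_vec m)) -
      act (graft_tree (basis_vec b) (basis_vec a)) (basis_vec m)"
    \<comment> \<open>Both sides are double sums over pairs of vertices of \<open>?M\<close>; after
      exchanging the summations on one side, \<open>comm\<close> matches them term by term.\<close>
    unfolding act_act_diff by (subst sum.swap) (intro sum.cong refl arg_cong[of _ _ basis_vec] comm)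
qed

lemma bilinear_act: "bilinear_map vscale vscale vscale act"
  unfolding act_def by (rule bilinear_map_bilin_ext)

end

section \<open>The three instances: trees, forests and couples\<close>

interpretation tree: graft_class
  "\<lambda>(t, s). s = t \<and> rooted_tree t" "\<lambda>x. abs_rtree (fst x)" "\<lambda>b. (rep_rtree b, rep_rtree b)"
proof (unfold_locales, goal_cases)
  case (3 x y)
  then have "tree_rel (fst x) (fst y)"
    by (auto simp: tree_rel_def rgraph_iso_couple_iso)
  then show ?case
    by (rule Quotient3_rel_abs[OF Quotient3_rtree])
next
  case (5 x)
  then show ?case
    by (auto simp: rooted_tree_def)
qed (auto simp: rooted_tree_rep abs_rtree_rep graft_pair_def rooted_tree_graft_at
    rgraph_iso_rep_abs_rtree simp flip: rgraph_iso_couple_iso)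

lemma rgraph_iso_rep_abs_rforest: "rooted_forest s \<Longrightarrow> rgraph_iso (rep_rforest (abs_rforest s)) s"
  using Quotient3_rep_abs[OF Quotient3_rforest, of s]
  by (simp add: forest_rel_def rgraph_iso_refl)

lemma abs_rforest_eq:
  "rooted_forest s \<Longrightarrow> rooted_forest s' \<Longrightarrow> rgraph_iso s s' \<Longrightarrow> abs_rforest s = abs_rforest s'"
  by (rule Quotient3_rel_abs[OF Quotient3_rforest]) (simp add: forest_rel_def)

interpretation forest: graft_class
  "\<lambda>(t, s). s = t \<and> rooted_forest t" "\<lambda>x. abs_rforest (fst x)"
  "\<lambda>b. (rep_rforest b, rep_rforest b)"
proof (unfold_locales, goal_cases)
  case (1 b)
  then show ?case
    using Quotient3_rep_reflp[OF Quotient3_rforest, of b] by (simp add: forest_rel_def)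
next
  case (3 x y)
  then show ?case
    by (auto simp: rgraph_iso_couple_iso intro!: abs_rforest_eq)
next
  case (5 x)
  then show ?case
    by (auto simp: rooted_forest_iff)
qed (auto simp: Quotient3_abs_rep[OF Quotient3_rforest] graft_pair_def rooted_forest_graft_at
    rgraph_iso_rep_abs_rforest simp flip: rgraph_iso_couple_iso)

lemma is_couple_rep: "is_couple (rep_couple b)"
  using Quotient3_rep_reflp[OF Quotient3_couple, of b] by (simp add: couple_rel_def)

lemma couple_iso_refl: "couple_iso x x"
proof -
  have "relabel id g = g" for g :: "'a rgraph"
    by (cases g) (simp add: relabel_def prod.map_id0)
  then show ?thesis
    by (auto simp: couple_iso_def split_beta intro!: exI[of _ id])
qed

lemma couple_iso_rep_abs: "is_couple x \<Longrightarrow> couple_iso (rep_couple (abs_couple x)) x"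
  using Quotient3_rep_abs[OF Quotient3_couple, of x] by (simp add: couple_rel_def couple_iso_refl)

interpretation couple: graft_class is_couple abs_couple rep_couple
proof (unfold_locales, goal_cases)
  case (3 x y)
  then show ?case
    by (intro Quotient3_rel_abs[OF Quotient3_couple]) (simp add: couple_rel_def)
next
  case (5 x)
  then show ?case
    by (cases x) (auto simp: rooted_forest_iff dest!: rooted_forest_couple)
next
  case (6 x)
  then show ?case
    by (cases x) (auto dest: couple_subgraph)
next
  case (7 t x v)
  then show ?case
    by (cases x) (simp add: graft_pair_def is_couple_graft_at)
qed (simp_all add: is_couple_rep Quotient3_abs_rep[OF Quotient3_couple] couple_iso_rep_abs)

section \<open>Module structures and the projection\<close>

lemma graft_tree_eq: "graft_tree = tree.act"
  by (simp add: graft_tree_def tree.act_def tree.graft_sum_def graft_pair_def)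

lemma graft_forest_eq: "graft_forest = forest.act"
  by (simp add: graft_forest_def forest.act_def forest.graft_sum_def graft_pair_def)

lemma diamond_eq: "diamond = couple.act"
  by (simp add: diamond_def couple.act_def couple.graft_sum_def graft_pair_def map_prod_def
      split_beta Let_def)

text \<open>In the instance \<open>tree\<close> the action is the product itself, so the module
  identity becomes the pre-Lie identity.\<close>

lemma left_pre_lie_algebra_graft_tree: "left_pre_lie_algebra vscale graft_tree"
proof (intro left_pre_lie_algebra.intro left_pre_lie_algebra_axioms.intro vector_space_vscale)
  show "bilinear_map vscale vscale vscale graft_tree"
    unfolding graft_tree_eq by (rule tree.bilinear_act)
qed (rule tree.act_pre_lie[folded graft_tree_eq])

lemma (in graft_class) left_pre_lie_module_act: "left_pre_lie_module vscale graft_tree vscale act"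
  by (intro left_pre_lie_module.intro left_pre_lie_module_axioms.intro vector_space_vscale
      left_pre_lie_algebra_graft_tree bilinear_act act_pre_lie)

text \<open>Makes \<open>P2\<close> independent of representatives: an isomorphism of couples is
  injective on the vertices of the tree, hence restricts to an isomorphism of the
  subforests.\<close>

lemma P2_abs: "is_couple (t, s) \<Longrightarrow> P2 (basis_vec (abs_couple (t, s))) = basis_vec (abs_rforest s)"
proof -
  assume ts: "is_couple (t, s)"
  obtain t' s' where rep: "rep_couple (abs_couple (t, s)) = (t', s')"
    by fastforce
  have s': "rooted_forest s'"
    using is_couple_rep[of "abs_couple (t, s)"] rooted_forest_couple by (simp add: rep)
  have iso: "couple_iso (t', s') (t, s)"
    using couple_iso_rep_abs[OF ts] by (simp add: rep)
  have "verts s' \<subseteq> verts t'"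
    using is_couple_rep[of "abs_couple (t, s)"] couple_subgraph by (simp add: rep)
  with iso have "rgraph_iso s' s"
    unfolding couple_iso_def rgraph_iso_def by (auto intro: inj_on_subset)
  then have "abs_rforest s' = abs_rforest s"
    using s' rooted_forest_couple[OF ts] by (intro abs_rforest_eq)
  then show ?thesis
    by (simp add: P2_def rep)
qed

lemma P2_diamond: "P2 (diamond x y) = graft_forest x (P2 y)"
proof -
  interpret P2: Vector_Spaces.linear vscale vscale P2
    unfolding P2_def by (rule linear_lin_ext)
  have basis: "P2 (diamond (basis_vec a) (basis_vec b)) =
      graft_forest (basis_vec a) (P2 (basis_vec b))"
    for a b
  proof -
    obtain t s where ts: "rep_couple b = (t, s)"
      by fastforce
    have c: "is_couple (t, s)"
      using is_couple_rep[of b] by (simp add: ts)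
    have "P2 (diamond (basis_vec a) (basis_vec b)) =
        (\<Sum>v\<in>verts s.
           P2 (basis_vec (abs_couple (graft_at (rep_rtree a) v t, graft_at (rep_rtree a) v s))))"
      by (simp add: diamond_def ts P2.sum)
    also have "\<dots> = (\<Sum>v\<in>verts s. basis_vec (abs_rforest (graft_at (rep_rtree a) v s)))"
      by (intro sum.cong refl P2_abs is_couple_graft_at rooted_tree_rep c)
    also have "\<dots> = forest.graft_sum (rep_rtree a) (s, s)"
      by (simp add: forest.graft_sum_def graft_pair_def)
    \<comment> \<open>The chosen representative of the class of \<open>s\<close> may differ from
      \<open>s\<close>, hence the appeal to \<open>forest.act_abs\<close>.\<close>
    also have "\<dots> = graft_forest (basis_vec a) (basis_vec (abs_rforest s))"
      unfolding graft_forest_eq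
      by (subst forest.act_abs[of "rep_rtree a" "(s, s)", unfolded abs_rtree_rep fst_conv])
        (simp_all add: rooted_tree_rep rooted_forest_couple[OF c])
    finally show ?thesis
      by (simp add: P2_def ts)
  qed
  \<comment> \<open>Linearity of both sides in each argument extends the identity from basis
    vectors, first in \<open>y\<close> and then in \<open>x\<close>.\<close>
  have lin: "Vector_Spaces.linear vscale vscale (\<lambda>x. P2 (diamond x y))"
      "Vector_Spaces.linear vscale vscale (\<lambda>x. graft_forest x (P2 y))"
      "Vector_Spaces.linear vscale vscale (\<lambda>y. P2 (diamond x y))"
      "Vector_Spaces.linear vscale vscale (\<lambda>y. graft_forest x (P2 y))" for x y
    by (simp_all only: linear_vscale_iff P2.add P2.scale diamond_def graft_forest_def
        bilin_ext_linear simp_thms)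
  have "P2 (diamond (basis_vec a) y) = graft_forest (basis_vec a) (P2 y)" for a
    by (rule linear_eq_on_basis[OF lin(3,4) basis])
  then show ?thesis
    by (rule linear_eq_on_basis[OF lin(1,2)])
qed

theorem theorem9:
  shows "(\<forall>(t1 :: rtree \<Rightarrow>\<^sub>0 'k::field) (x :: couple \<Rightarrow>\<^sub>0 'k).
            P2 (diamond t1 x) = graft_forest t1 (P2 x)) \<and>
         pre_lie_module_morphism
           (vscale :: 'k \<Rightarrow> (rtree \<Rightarrow>\<^sub>0 'k) \<Rightarrow> _) graft_tree
           (vscale :: 'k \<Rightarrow> (couple \<Rightarrow>\<^sub>0 'k) \<Rightarrow> _) diamond
           (vscale :: 'k \<Rightarrow> (rforest \<Rightarrow>\<^sub>0 'k) \<Rightarrow> _) graft_forest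
           P2"
proof (intro conjI allI)
  show "P2 (diamond t1 x) = graft_forest t1 (P2 x)"
    for t1 :: "rtree \<Rightarrow>\<^sub>0 'k" and x :: "couple \<Rightarrow>\<^sub>0 'k"
    by (rule P2_diamond)
  show "pre_lie_module_morphism (vscale :: 'k \<Rightarrow> (rtree \<Rightarrow>\<^sub>0 'k) \<Rightarrow> _) graft_tree
      (vscale :: 'k \<Rightarrow> (couple \<Rightarrow>\<^sub>0 'k) \<Rightarrow> _) diamond
      (vscale :: 'k \<Rightarrow> (rforest \<Rightarrow>\<^sub>0 'k) \<Rightarrow> _) graft_forest P2"
  proof (intro pre_lie_module_morphism.intro pre_lie_module_morphism_axioms.intro)
    show "left_pre_lie_module (vscale :: 'k \<Rightarrow> _) graft_tree vscale diamond"
      unfolding diamond_eq by (rule couple.left_pre_lie_module_act)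
    show "left_pre_lie_module (vscale :: 'k \<Rightarrow> _) graft_tree vscale graft_forest"
      unfolding graft_forest_eq by (rule forest.left_pre_lie_module_act)
    show "Vector_Spaces.linear (vscale :: 'k \<Rightarrow> _) vscale P2"
      unfolding P2_def by (rule linear_lin_ext)
  qed (rule P2_diamond)
qed

end
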